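(* Let $F=(F_1,\dots,F_m):\mathbb{R}^n\to\mathbb{R}^m$ be continuously differentiable. Suppose that there exist constants $a,b>0$ such that $aI\preceq B_k\preceq bI$ for all $k$, and that for any $x^0\in\mathbb{R}^n$ the level set $\mathcal{L}_F(x^0)=\{x\in\mathbb{R}^n: F_i(x)\le F_i(x^0)\ \text{for all } i\in[m]\}$ is compact. Let $\{x^k\}$ be an infinite sequence of non-critical points generated by the BBDMO\_VM algorithm. Then $\{x^k\}$ has at least one accumulation point, and every accumulation point of $\{x^k\}$ is a Pareto critical point of $F$.
   Context: Notation: $[m]=\{1,\dots,m\}$; $\|x\|_B=\sqrt{\langle x,Bx\rangle}$ for a symmetric positive definite matrix $B$; for symmetric matrices $U\preceq V$ means $V-U$ is positive semidefinite. A point $x\in\mathbb{R}^n$ is Pareto critical if there is no $d\in\mathbb{R}^n$ with $\langle\nabla F_i(x),d\rangle<0$ for all $i\in[m]$; otherwise it is non-critical. BBDMO\_VM algorithm (Barzilai-Borwein descent method with variable metrics). Parameters: $0<\alpha_{\min}\le\alpha_{\max}$, $\sigma,\gamma\in(0,1)$. Data: $x^0\in\mathbb{R}^n$, a point $x^{-1}$ near $x^0$, and symmetric positive definite matrices $B_0,B_1,\dots$ ($B_{k+1}$ being chosen, by any rule, at the end of iteration $k$). For $k=0,1,2,\dots$: 1. With $s^{k-1}=x^k-x^{k-1}$ and $y_i^{k-1}=\nabla F_i(x^k)-\nabla F_i(x^{k-1})$, set for each $i\in[m]$: $\alpha_i^k=\max\{\alpha_{\min},\min\{\langle s^{k-1},y_i^{k-1}\rangle/\|s^{k-1}\|_{B_k}^2,\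 \alpha_{\max}\}\}$ if $\langle s^{k-1},y_i^{k-1}\rangle>0$; $\alpha_i^k=\max\{\alpha_{\min},\min\{\|y_i^{k-1}\|/\|B_ks^{k-1}\|,\ \alpha_{\max}\}\}$ if $\langle s^{k-1},y_i^{k-1}\rangle<0$; $\alpha_i^k=\alpha_{\min}$ if $\langle s^{k-1},y_i^{k-1}\rangle=0$. 2. Let $d^k$ be the unique minimizer over $d\in\mathbb{R}^n$ of $\max_{i\in[m]}\left\{\frac{\langle\nabla F_i(x^k),d\rangle}{\alpha_i^k}+\frac12\|d\|_{B_k}^2\right\}$. 3. If $d^k=0$, stop and return the Pareto critical point $x^k$. Otherwise let $t_k$ be the largest element of $\{1,\gamma,\gamma^2,\dots\}$ such that $F_i(x^k+t_kd^k)-F_i(x^k)\le t_k\sigma\langle\nabla F_i(x^k),d^k\rangle$ for all $i\in[m]$ (Armijo backtracking), and set $x^{k+1}=x^k+t_kd^k$. *)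

theory Defs
  imports "HOL-Analysis.Analysis"
begin

definition continuously_differentiable ::
    "('a::real_normed_vector \<Rightarrow> 'b::real_normed_vector) \<Rightarrow> bool" where
  "continuously_differentiable F \<longleftrightarrow>
     (\<exists>F'. (\<forall>x. (F has_derivative blinfun_apply (F' x)) (at x)) \<and> continuous_on UNIV F')"

text \<open>Meaningful only where \<open>f\<close> is differentiable, see \<open>grad_eq\<close>.\<close>

definition grad :: "('a::real_inner \<Rightarrow> real) \<Rightarrow> 'a \<Rightarrow> 'a" where
  "grad f x = (THE D. GDERIV f x :> D)"

lemma grad_eq:
  assumes "GDERIV f x :> D"
  shows "grad f x = D"
  unfolding grad_def
proof (rule the_equality)
  fix D' assume "GDERIV f x :> D'"
  with assms have "(\<lambda>h. inner h D') = (\<lambda>h. inner h D)"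
    unfolding gderiv_def by (rule has_derivative_unique[rotated])
  then have "inner h D' = inner h D" for h
    by meson
  then show "D' = D"
    by (metis vector_eq_ldot)
qed (rule assms)

definition symmetric_mat :: "real^'n^'n \<Rightarrow> bool" where
  "symmetric_mat B \<longleftrightarrow> transpose B = B"

definition pos_semidef :: "real^'n^'n \<Rightarrow> bool" where
  "pos_semidef B \<longleftrightarrow> symmetric_mat B \<and> (\<forall>v. 0 \<le> v \<bullet> (B *v v))"

definition pos_def :: "real^'n^'n \<Rightarrow> bool" where
  "pos_def B \<longleftrightarrow> symmetric_mat B \<and> (\<forall>v. v \<noteq> 0 \<longrightarrow> 0 < v \<bullet> (B *v v))"

definition loewner_le :: "real^'n^'n \<Rightarrow> real^'n^'n \<Rightarrow> bool" where
  "loewner_le U V \<longleftrightarrow> pos_semidef (V - U)"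

definition mat_norm :: "real^'n^'n \<Rightarrow> real^'n \<Rightarrow> real" where
  "mat_norm B v = sqrt (v \<bullet> (B *v v))"

definition obj_grad :: "(real^'n \<Rightarrow> real^'m) \<Rightarrow> 'm \<Rightarrow> real^'n \<Rightarrow> real^'n" where
  "obj_grad F i = grad (\<lambda>x. F x $ i)"

definition pareto_critical :: "(real^'n \<Rightarrow> real^'m) \<Rightarrow> real^'n \<Rightarrow> bool" where
  "pareto_critical F x \<longleftrightarrow> \<not> (\<exists>d. \<forall>i. obj_grad F i x \<bullet> d < 0)"

definition level_set :: "(real^'n \<Rightarrow> real^'m) \<Rightarrow> real^'n \<Rightarrow> (real^'n) set" where
  "level_set F x0 = {x. \<forall>i. F x $ i \<le> F x0 $ i}"

definition accumulation_point :: "(nat \<Rightarrow> 'a::topological_space) \<Rightarrow> 'a \<Rightarrow> bool" where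
  "accumulation_point x z \<longleftrightarrow> (\<exists>r. strict_mono r \<and> (x \<circ> r) \<longlonglongrightarrow> z)"

definition bb_coeff :: "real \<Rightarrow> real \<Rightarrow> real^'n^'n \<Rightarrow> real^'n \<Rightarrow> real^'n \<Rightarrow> real" where
  "bb_coeff \<alpha>min \<alpha>max B s y =
     (if s \<bullet> y > 0 then max \<alpha>min (min ((s \<bullet> y) / (mat_norm B s)\<^sup>2) \<alpha>max)
      else if s \<bullet> y < 0 then max \<alpha>min (min (norm y / norm (B *v s)) \<alpha>max)
      else \<alpha>min)"

text \<open>The sequence \<open>x\<close> is indexed from \<open>0\<close>; \<open>xm1\<close> stands for the iterate of index \<open>-1\<close>.\<close>

definition prev_iterate :: "'a \<Rightarrow> (nat \<Rightarrow> 'a) \<Rightarrow> nat \<Rightarrow> 'a" where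
  "prev_iterate xm1 x k = (case k of 0 \<Rightarrow> xm1 | Suc j \<Rightarrow> x j)"

definition bb_alpha ::
    "real \<Rightarrow> real \<Rightarrow> (real^'n \<Rightarrow> real^'m) \<Rightarrow> (nat \<Rightarrow> real^'n^'n) \<Rightarrow>
     real^'n \<Rightarrow> (nat \<Rightarrow> real^'n) \<Rightarrow> nat \<Rightarrow> 'm \<Rightarrow> real" where
  "bb_alpha \<alpha>min \<alpha>max F B xm1 x k i =
     bb_coeff \<alpha>min \<alpha>max (B k)
       (x k - prev_iterate xm1 x k)
       (obj_grad F i (x k) - obj_grad F i (prev_iterate xm1 x k))"

definition direction_objective ::
    "(real^'n \<Rightarrow> real^'m) \<Rightarrow> real^'n^'n \<Rightarrow> ('m \<Rightarrow> real) \<Rightarrow> real^'n \<Rightarrow> real^'n \<Rightarrow> real" where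
  "direction_objective F B \<alpha> x d =
     (MAX i. (obj_grad F i x \<bullet> d) / \<alpha> i + 1 / 2 * (mat_norm B d)\<^sup>2)"

definition armijo ::
    "real \<Rightarrow> (real^'n \<Rightarrow> real^'m) \<Rightarrow> real^'n \<Rightarrow> real^'n \<Rightarrow> real \<Rightarrow> bool" where
  "armijo \<sigma> F x d t \<longleftrightarrow>
     (\<forall>i. F (x + t *\<^sub>R d) $ i - F x $ i \<le> t * \<sigma> * (obj_grad F i x \<bullet> d))"

definition armijo_step ::
    "real \<Rightarrow> real \<Rightarrow> (real^'n \<Rightarrow> real^'m) \<Rightarrow> real^'n \<Rightarrow> real^'n \<Rightarrow> real \<Rightarrow> bool" where
  "armijo_step \<sigma> \<gamma> F x d t \<longleftrightarrow>
     is_arg_max (\<lambda>s. s) (\<lambda>s. s \<in> range (\<lambda>j::nat. \<gamma> ^ j) \<and> armijo \<sigma> F x d s) t"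

text \<open>An infinite run of the algorithm: every iteration passes the stopping test \<open>d k = 0\<close>.
  For positive definite \<open>B k\<close> and positive coefficients the objective of the direction
  subproblem is strictly convex, so that its minimizer \<open>d k\<close> is unique.
  The matrices \<open>B\<close> are part of the data, since they may be chosen by any rule.\<close>

definition bbdmo_vm_run ::
    "real \<Rightarrow> real \<Rightarrow> real \<Rightarrow> real \<Rightarrow> (real^'n \<Rightarrow> real^'m) \<Rightarrow> (nat \<Rightarrow> real^'n^'n) \<Rightarrow>
     real^'n \<Rightarrow> (nat \<Rightarrow> real^'n) \<Rightarrow> bool" where
  "bbdmo_vm_run \<alpha>min \<alpha>max \<sigma> \<gamma> F B xm1 x \<longleftrightarrow>
     (\<exists>d t. \<forall>k.
        is_arg_min (direction_objective F (B k) (bb_alpha \<alpha>min \<alpha>max F B xm1 x k) (x k))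
          (\<lambda>_. True) (d k) \<and>
        d k \<noteq> 0 \<and>
        armijo_step \<sigma> \<gamma> F (x k) (d k) (t k) \<and>
        x (Suc k) = x k + t k *\<^sub>R d k)"

end

theory Submission
  imports Defs
begin

text \<open>Comparing the minimizer \<open>d k\<close> with its positive multiples gives
  \<open>\<langle>\<nabla>F\<^sub>i(x k), d k\<rangle> / \<alpha>\<^sub>i \<le> - \<parallel>d k\<parallel>\<^sup>2\<close> in the norm of \<open>B k\<close>, so the Armijo
  condition forces a decrease of order \<open>t k \<parallel>d k\<parallel>\<^sup>2\<close>; the iterates stay in a compact level set and
  \<open>t k \<parallel>d k\<parallel>\<^sup>2 \<longlonglongrightarrow> 0\<close>. Near a non-critical point some fixed \<open>v\<close> is a common descent direction, and
  comparing \<open>d k\<close> with multiples of \<open>v\<close> bounds \<open>\<parallel>d k\<parallel>\<close> away from \<open>0\<close>. If such a point were an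
  accumulation point, then \<open>t k\<close> would get small, so the larger step \<open>t k / \<gamma>\<close> would have been rejected,
  and by the mean value theorem some gradient would vary by a fixed amount within an
  arbitrarily small neighbourhood.\<close>

section \<open>Summable decrease and gradients of the components\<close>

text \<open>The decreases telescope, so every partial sum of \<open>e\<close> is at most
  \<open>f 0 - c\<close>; a series of nonnegative terms with bounded partial sums converges, and its
  terms vanish.\<close>

lemma bounded_descent_tendsto_0:
  fixes f e :: "nat \<Rightarrow> real"
  assumes "\<And>k. 0 \<le> e k" and "\<And>k. e k \<le> f k - f (Suc k)" and "\<And>k. c \<le> f k"
  shows "e \<longlonglongrightarrow> 0"
proof -
  have "(\<Sum>k\<le>n. e k) \<le> f 0 - f (Suc n)" for n
  proof (induction n)
    case 0
    show ?case using assms(2)[of 0] by simp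
  next
    case (Suc n)
    then show ?case using assms(2)[of "Suc n"] by simp
  qed
  then have "(\<Sum>k\<le>n. e k) \<le> f 0 - c" for n
    using assms(3)[of "Suc n"] by (meson diff_left_mono order_trans)
  with assms(1) have "summable e" by (rule bounded_imp_summable)
  then show ?thesis by (rule summable_LIMSEQ_zero)
qed

lemma obj_grad_continuously_differentiable:
  fixes F :: "real^'n \<Rightarrow> real^'m"
  assumes "continuously_differentiable F"
  shows has_derivative_obj_grad: "((\<lambda>y. F y $ i) has_derivative (\<lambda>h. obj_grad F i x \<bullet> h)) (at x)"
    and continuous_obj_grad: "continuous_on UNIV (obj_grad F i)"
proof -
  obtain F' where F': "\<And>x. (F has_derivative blinfun_apply (F' x)) (at x)"
    and cont: "continuous_on UNIV F'"
    using assms unfolding continuously_differentiable_def by blast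
  \<comment> \<open>Row \<open>i\<close> of the Jacobian, written entrywise so that its continuity
    is inherited from \<open>F'\<close>. It is also the adjoint of \<open>F' x\<close> applied to
    \<open>axis i 1\<close>, which makes it the gradient of component \<open>i\<close>.\<close>
  define D where "D x = (\<chi> j. F' x (axis j 1) $ i)" for x
  have D: "h \<bullet> D x = F' x h $ i" for x h
  proof -
    have lin: "linear (blinfun_apply (F' x))"
      by (simp add: blinfun.bounded_linear_right bounded_linear.linear)
    have "adjoint (F' x) (axis i 1) $ j = D x $ j" for j
    proof -
      have "adjoint (F' x) (axis i 1) $ j = axis j 1 \<bullet> adjoint (F' x) (axis i 1)"
        by (simp add: inner_axis')
      also have "\<dots> = F' x (axis j 1) \<bullet> axis i 1"
        by (rule adjoint_works[OF lin])
      finally show ?thesis by (simp add: D_def inner_axis)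
    qed
    then have "D x = adjoint (F' x) (axis i 1)" by (simp add: vec_eq_iff)
    then have "h \<bullet> D x = F' x h \<bullet> axis i 1" by (simp add: adjoint_works[OF lin])
    then show ?thesis by (simp add: inner_axis)
  qed
  have der: "((\<lambda>y. F y $ i) has_derivative (\<lambda>h. h \<bullet> D x)) (at x)" for x
    unfolding D by (rule bounded_linear.has_derivative[OF bounded_linear_vec_nth F'])
  then have "obj_grad F i x = D x" for x
    unfolding obj_grad_def by (intro grad_eq) (simp add: gderiv_def)
  then have grad: "obj_grad F i = D" ..
  show "((\<lambda>y. F y $ i) has_derivative (\<lambda>h. obj_grad F i x \<bullet> h)) (at x)"
    using der[of x] by (simp add: grad inner_commute)
  have "continuous_on UNIV D"
    unfolding D_def by (intro continuous_intros cont)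
  then show "continuous_on UNIV (obj_grad F i)"
    by (simp add: grad)
qed

section \<open>Bounds on the metrics and the coefficients\<close>

lemma loewner_bounds_mat_norm:
  fixes B :: "real^'n^'n"
  assumes "0 \<le> a" "loewner_le (a *\<^sub>R mat 1) B" "loewner_le B (b *\<^sub>R mat 1)"
  shows "a * (norm v)\<^sup>2 \<le> (mat_norm B v)\<^sup>2" and "(mat_norm B v)\<^sup>2 \<le> b * (norm v)\<^sup>2"
proof -
  have scal: "((c *\<^sub>R mat 1) :: real^'n^'n) *v v = c *\<^sub>R v" for c v
    by (simp flip: scaleR_matrix_vector_assoc)
  have lo: "a * (norm v)\<^sup>2 \<le> v \<bullet> (B *v v)"
    using assms(2) by (simp add: loewner_le_def pos_semidef_def matrix_vector_mult_diff_rdistrib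
        scal inner_diff_right power2_norm_eq_inner)
  have hi: "v \<bullet> (B *v v) \<le> b * (norm v)\<^sup>2"
    using assms(3) by (simp add: loewner_le_def pos_semidef_def matrix_vector_mult_diff_rdistrib
        scal inner_diff_right power2_norm_eq_inner)
  \<comment> \<open>Nonnegativity of the quadratic form lets the square cancel the square root in
    \<open>mat_norm\<close>.\<close>
  have "0 \<le> a * (norm v)\<^sup>2" using assms(1) by simp
  then have "(mat_norm B v)\<^sup>2 = v \<bullet> (B *v v)"
    using lo by (simp add: mat_norm_def)
  then show "a * (norm v)\<^sup>2 \<le> (mat_norm B v)\<^sup>2" "(mat_norm B v)\<^sup>2 \<le> b * (norm v)\<^sup>2"
    using lo hi by simp_all
qed

text \<open>True even where the quadratic form is negative, because \<open>sqrt\<close> is odd and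
  multiplicative on all reals.\<close>

lemma mat_norm_scaleR: "(mat_norm B (c *\<^sub>R v))\<^sup>2 = c\<^sup>2 * (mat_norm B v)\<^sup>2"
  by (simp add: mat_norm_def matrix_vector_mult_scaleR real_sqrt_mult power_mult_distrib
      flip: mult.assoc power2_eq_square)

lemma bb_alpha_bounds:
  assumes "\<alpha>min \<le> \<alpha>max"
  shows "\<alpha>min \<le> bb_alpha \<alpha>min \<alpha>max F B xm1 x k i" "bb_alpha \<alpha>min \<alpha>max F B xm1 x k i \<le> \<alpha>max"
  using assms by (auto simp: bb_alpha_def bb_coeff_def)

section \<open>The direction subproblem\<close>

lemma direction_objective_le_iff:
  fixes F :: "real^'n \<Rightarrow> real^'m"
  shows "direction_objective F B \<alpha> x d \<le> c \<longleftrightarrow>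
    (\<forall>i. (obj_grad F i x \<bullet> d) / \<alpha> i + 1 / 2 * (mat_norm B d)\<^sup>2 \<le> c)"
  unfolding direction_objective_def by (subst Max_le_iff) auto

text \<open>Optimality is tested only along the ray through \<open>d\<close>. With \<open>M\<close>
  the largest scaled slope and \<open>Q\<close> the squared metric norm, the objective at
  \<open>c *\<^sub>R d\<close> is at most \<open>c * M + c\<^sup>2 * Q / 2\<close>, with equality at
  \<open>c = 1\<close>. As no \<open>c \<ge> 0\<close> does better than \<open>1\<close>, it follows
  that \<open>M = - Q\<close>.\<close>

lemma direction_minimizer:
  fixes F :: "real^'n \<Rightarrow> real^'m"
  assumes min: "is_arg_min (direction_objective F B \<alpha> x) (\<lambda>_. True) d"
    and pos: "0 < mat_norm B d"
  shows minimizer_descent: "(obj_grad F i x \<bullet> d) / \<alpha> i \<le> - (mat_norm B d)\<^sup>2"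
    and minimizer_value: "direction_objective F B \<alpha> x d = - (mat_norm B d)\<^sup>2 / 2"
proof -
  define Q where "Q = (mat_norm B d)\<^sup>2"
  define M where "M = direction_objective F B \<alpha> x d - Q / 2"
  have Q: "0 < Q" using pos by (simp add: Q_def)
  have le: "direction_objective F B \<alpha> x d \<le> direction_objective F B \<alpha> x e" for e
    using min by (simp add: is_arg_min_linorder)
  have M: "(obj_grad F i x \<bullet> d) / \<alpha> i \<le> M" for i
    using direction_objective_le_iff[of F B \<alpha> x d "direction_objective F B \<alpha> x d"]
    by (simp add: M_def Q_def algebra_simps)
  have scaled: "M + Q / 2 \<le> c * M + c\<^sup>2 * Q / 2" if "0 \<le> c" for c
  proof -
    have "direction_objective F B \<alpha> x (c *\<^sub>R d) \<le> c * M + c\<^sup>2 * Q / 2"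
      unfolding direction_objective_le_iff mat_norm_scaleR Q_def[symmetric]
      using mult_left_mono[OF M that] by simp
    with le[of "c *\<^sub>R d"] show ?thesis by (simp add: M_def)
  qed
  \<comment> \<open>Multiplier \<open>0\<close> fixes the sign of \<open>M\<close>, so that the
    vertex \<open>- M / Q\<close> of the quadratic in \<open>c\<close> is an admissible
    multiplier.\<close>
  have "M \<le> 0" using scaled[of 0] Q by simp
  then have "M + Q / 2 \<le> (- M / Q) * M + (- M / Q)\<^sup>2 * Q / 2"
    using Q by (intro scaled) (simp add: divide_nonpos_pos)
  also have "\<dots> = - M\<^sup>2 / (2 * Q)"
    using Q by (simp add: field_simps power2_eq_square)
  finally have "(M + Q)\<^sup>2 \<le> 0"
    using Q by (simp add: field_simps power2_eq_square)
  then have "M = - Q" by simp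
  then show "(obj_grad F i x \<bullet> d) / \<alpha> i \<le> - (mat_norm B d)\<^sup>2"
    and "direction_objective F B \<alpha> x d = - (mat_norm B d)\<^sup>2 / 2"
    using M[of i] by (simp_all add: M_def Q_def)
qed

text \<open>The optimal value is half the negative squared metric norm of \<open>d\<close>, while a
  multiple of the descent direction \<open>v\<close> already reaches a definite negative value. The
  bound depends on the point only through \<open>\<delta>\<close> and \<open>v\<close>, hence is
  uniform over iterates.\<close>

lemma minimizer_norm_lower_bound:
  fixes F :: "real^'n \<Rightarrow> real^'m"
  assumes min: "is_arg_min (direction_objective F B \<alpha> x) (\<lambda>_. True) d"
    and pos: "0 < mat_norm B d"
    and hi: "\<And>w. (mat_norm B w)\<^sup>2 \<le> b * (norm w)\<^sup>2" and "0 < b"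
    and \<alpha>: "\<And>i. 0 < \<alpha> i" "\<And>i. \<alpha> i \<le> \<alpha>max"
    and v: "\<And>i. obj_grad F i x \<bullet> v \<le> - \<delta>" and "0 < \<delta>"
  shows "\<delta> / (\<alpha>max * b * norm v) \<le> norm d"
proof -
  have "v \<noteq> 0" using v \<open>0 < \<delta>\<close> by force
  then have nv: "0 < norm v" by simp
  have "0 < \<alpha>max" using \<alpha> less_le_trans by blast
  \<comment> \<open>This \<open>c\<close> minimizes \<open>- (c * \<delta> / \<alpha>max) + b *
    c\<^sup>2 * (norm v)\<^sup>2 / 2\<close>, the upper bound for the objective along
    \<open>v\<close>.\<close>
  define c where "c = \<delta> / (\<alpha>max * b * (norm v)\<^sup>2)"
  have c: "0 < c" using \<open>0 < \<delta>\<close> \<open>0 < \<alpha>max\<close> \<open>0 < b\<close> nv by (simp add: c_def)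
  have step: "(obj_grad F i x \<bullet> (c *\<^sub>R v)) / \<alpha> i \<le> - (c * \<delta> / \<alpha>max)" for i
  proof -
    have "(obj_grad F i x \<bullet> (c *\<^sub>R v)) / \<alpha> i \<le> (c * (- \<delta>)) / \<alpha> i"
      unfolding inner_scaleR_right
      using v[of i] c \<alpha>(1)[of i] by (intro divide_right_mono mult_left_mono) auto
    moreover have "c * \<delta> / \<alpha>max \<le> c * \<delta> / \<alpha> i"
      using c \<open>0 < \<delta>\<close> \<alpha>(1)[of i] \<alpha>(2)[of i] by (intro divide_left_mono) auto
    ultimately show ?thesis by simp
  qed
  have sq: "(mat_norm B (c *\<^sub>R v))\<^sup>2 \<le> b * c\<^sup>2 * (norm v)\<^sup>2"
    using hi[of "c *\<^sub>R v"] by (simp add: power_mult_distrib)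
  have "direction_objective F B \<alpha> x (c *\<^sub>R v)
      \<le> - (c * \<delta> / \<alpha>max) + b * c\<^sup>2 * (norm v)\<^sup>2 / 2"
    unfolding direction_objective_le_iff
  proof
    fix i
    from step[of i] sq show "(obj_grad F i x \<bullet> (c *\<^sub>R v)) / \<alpha> i + 1 / 2 * (mat_norm B (c *\<^sub>R v))\<^sup>2
        \<le> - (c * \<delta> / \<alpha>max) + b * c\<^sup>2 * (norm v)\<^sup>2 / 2" by linarith
  qed
  moreover have "b * c\<^sup>2 * (norm v)\<^sup>2 = c * \<delta> / \<alpha>max"
    using \<open>0 < b\<close> nv \<open>0 < \<alpha>max\<close> by (simp add: c_def field_simps power2_eq_square)
  moreover have "direction_objective F B \<alpha> x d \<le> direction_objective F B \<alpha> x (c *\<^sub>R v)"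
    using min by (simp add: is_arg_min_linorder)
  ultimately have "c * \<delta> / \<alpha>max \<le> (mat_norm B d)\<^sup>2"
    unfolding minimizer_value[OF min pos] by linarith
  also have "\<dots> \<le> b * (norm d)\<^sup>2" by (rule hi)
  finally have "(\<delta> / (\<alpha>max * b * norm v))\<^sup>2 \<le> (norm d)\<^sup>2"
    using \<open>0 < b\<close> nv \<open>0 < \<alpha>max\<close> by (simp add: c_def field_simps power2_eq_square)
  then show ?thesis by (rule power2_le_imp_le) simp
qed

section \<open>Armijo line search\<close>

text \<open>A rejected step has, for some component, a difference quotient above
  \<open>\<sigma>\<close> times the initial slope; the mean value theorem realizes this quotient as
  a slope at an intermediate point.\<close>

lemma not_armijo_gradient:
  fixes F :: "real^'n \<Rightarrow> real^'m"
  assumes "continuously_differentiable F" and "\<not> armijo \<sigma> F x d s" and "0 < s"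
  obtains i u where "0 < u" "u < s" "\<sigma> * (obj_grad F i x \<bullet> d) < obj_grad F i (x + u *\<^sub>R d) \<bullet> d"
proof -
  obtain i where i: "s * \<sigma> * (obj_grad F i x \<bullet> d) < F (x + s *\<^sub>R d) $ i - F x $ i"
    using assms(2) by (auto simp: armijo_def not_le)
  have "((\<lambda>u. F (x + u *\<^sub>R d) $ i) has_real_derivative obj_grad F i (x + u *\<^sub>R d) \<bullet> d) (at u)" for u
    unfolding has_field_derivative_def
    by (rule has_derivative_eq_rhs,
        rule has_derivative_compose[OF _ has_derivative_obj_grad[OF assms(1)]])
      (auto intro!: derivative_eq_intros simp: fun_eq_iff)
  from MVT2[OF \<open>0 < s\<close> this] obtain u where u: "0 < u" "u < s"
    and "F (x + s *\<^sub>R d) $ i - F x $ i = s * (obj_grad F i (x + u *\<^sub>R d) \<bullet> d)"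
    by auto
  with i \<open>0 < s\<close> have "\<sigma> * (obj_grad F i x \<bullet> d) < obj_grad F i (x + u *\<^sub>R d) \<bullet> d"
    by (simp add: mult.assoc)
  with u show thesis by (rule that)
qed

lemma armijo_step_backtrack:
  assumes "armijo_step \<sigma> \<gamma> F x d t" and "0 < \<gamma>" "\<gamma> < 1"
  shows "0 < t" "armijo \<sigma> F x d t" "t < 1 \<Longrightarrow> \<not> armijo \<sigma> F x d (t / \<gamma>)"
proof -
  have t: "t \<in> range (\<lambda>j::nat. \<gamma> ^ j)" "armijo \<sigma> F x d t"
    and max: "\<And>s. s \<in> range (\<lambda>j::nat. \<gamma> ^ j) \<Longrightarrow> armijo \<sigma> F x d s \<Longrightarrow> s \<le> t"
    using assms(1) by (auto simp: armijo_step_def is_arg_max_linorder)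
  then obtain j where j: "t = \<gamma> ^ j" by blast
  show pos: "0 < t" and "armijo \<sigma> F x d t" using j assms(2) t by simp_all
  show "\<not> armijo \<sigma> F x d (t / \<gamma>)" if "t < 1"
  proof
    assume "armijo \<sigma> F x d (t / \<gamma>)"
    \<comment> \<open>\<open>t < 1\<close> rules out exponent \<open>0\<close>, so dividing by
      \<open>\<gamma>\<close> just lowers the exponent by one.\<close>
    moreover have "t / \<gamma> \<in> range (\<lambda>j::nat. \<gamma> ^ j)"
      using j that assms(2) by (cases j) auto
    ultimately have "t / \<gamma> \<le> t" by (rule max[rotated])
    then show False using pos assms(2,3) by (simp add: field_simps)
  qed
qed

section \<open>Accumulation points\<close>

lemma accumulation_point_frequently:
  fixes x :: "nat \<Rightarrow> 'a::metric_space"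
  assumes "accumulation_point x z" and "0 < e" and "eventually P sequentially"
  obtains k where "dist (x k) z < e" "P k"
proof -
  obtain r where "strict_mono r" "(x \<circ> r) \<longlonglongrightarrow> z"
    using assms(1) by (auto simp: accumulation_point_def)
  then have "\<forall>\<^sub>F n in sequentially. dist (x (r n)) z < e" "\<forall>\<^sub>F n in sequentially. P (r n)"
    using assms(2,3) by (auto dest: tendstoD eventually_subseq)
  then have "\<forall>\<^sub>F n in sequentially. dist (x (r n)) z < e \<and> P (r n)"
    by (rule eventually_conj)
  then show thesis using that eventually_happens'[OF sequentially_bot] by blast
qed

text \<open>The run enters through its estimates: \<open>descent\<close> and \<open>lower\<close>
  come from the subproblem, \<open>backtrack\<close> and \<open>small\<close> from the line search.
  The contradiction arises at a single well-chosen index \<open>k\<close>.\<close>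

lemma accumulation_point_pareto_critical:
  fixes F :: "real^'n \<Rightarrow> real^'m"
  assumes F: "continuously_differentiable F"
    and "\<sigma> < 1" "0 < \<gamma>" "0 < c"
    and t: "\<And>k. 0 < t k"
    and backtrack: "\<And>k. t k < 1 \<Longrightarrow> \<not> armijo \<sigma> F (x k) (d k) (t k / \<gamma>)"
    and descent: "\<And>i k. obj_grad F i (x k) \<bullet> d k \<le> - (c * (norm (d k))\<^sup>2)"
    and lower: "\<And>v \<delta>. 0 < \<delta> \<Longrightarrow>
      \<exists>D>0. \<forall>k. (\<forall>i. obj_grad F i (x k) \<bullet> v \<le> - \<delta>) \<longrightarrow> D \<le> norm (d k)"
    and small: "(\<lambda>k. t k * (norm (d k))\<^sup>2) \<longlonglongrightarrow> 0"
    and z: "accumulation_point x z"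
  shows "pareto_critical F z"
proof (rule ccontr)
  assume "\<not> pareto_critical F z"
  then obtain v where v: "\<And>i. obj_grad F i z \<bullet> v < 0" by (auto simp: pareto_critical_def)
  \<comment> \<open>Half of the slowest descent rate of \<open>v\<close> at \<open>z\<close>; the
    other half absorbs the change of gradients near \<open>z\<close>.\<close>
  define \<delta> where "\<delta> = Min (range (\<lambda>i. - (obj_grad F i z \<bullet> v))) / 2"
  have "0 < \<delta>" using v by (simp add: \<delta>_def)
  have \<delta>: "obj_grad F i z \<bullet> v \<le> - 2 * \<delta>" for i
  proof -
    have "2 * \<delta> \<le> - (obj_grad F i z \<bullet> v)"
      unfolding \<delta>_def by (simp add: Min_le)
    then show ?thesis by simp
  qed
  have "v \<noteq> 0" using v by force
  from lower[OF \<open>0 < \<delta>\<close>] obtain D where "0 < D"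
    and D_le: "\<And>k. (\<And>i. obj_grad F i (x k) \<bullet> v \<le> - \<delta>) \<Longrightarrow> D \<le> norm (d k)" by blast
  define \<kappa> where "\<kappa> = (1 - \<sigma>) * c * D"
  have "0 < \<kappa>" using \<open>\<sigma> < 1\<close> \<open>0 < c\<close> \<open>0 < D\<close> by (simp add: \<kappa>_def)
  \<comment> \<open>The term \<open>\<kappa> / 2\<close> keeps gradients at any two points near
    \<open>z\<close> less than \<open>\<kappa>\<close> apart; \<open>\<delta> / norm v\<close> keeps
    the descent rate of \<open>v\<close> at least \<open>\<delta>\<close>.\<close>
  define \<epsilon> where "\<epsilon> = min (\<kappa> / 2) (\<delta> / norm v)"
  have "0 < \<epsilon>" using \<open>0 < \<kappa>\<close> \<open>0 < \<delta>\<close> \<open>v \<noteq> 0\<close> by (simp add: \<epsilon>_def)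
  have "\<forall>\<^sub>F y in nhds z. dist (obj_grad F i y) (obj_grad F i z) < \<epsilon>" for i
    using continuous_obj_grad[OF F, of i] \<open>0 < \<epsilon>\<close>
    by (simp add: continuous_on_eq_continuous_at isCont_def tendsto_at_iff_tendsto_nhds tendstoD)
  then have "\<forall>\<^sub>F y in nhds z. \<forall>i. dist (obj_grad F i y) (obj_grad F i z) < \<epsilon>"
    by (rule eventually_all_finite)
  then obtain r where "0 < r"
    and r: "\<And>y i. dist y z < r \<Longrightarrow> norm (obj_grad F i y - obj_grad F i z) < \<epsilon>"
    by (auto simp: eventually_nhds_metric dist_norm)
  \<comment> \<open>The first bound will force \<open>t k < 1\<close>, so that a larger step was
    rejected; the second keeps the intermediate point within \<open>r\<close> of
    \<open>z\<close>.\<close>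
  define \<eta> where "\<eta> = min (D\<^sup>2) (\<gamma> * D * r / 2)"
  have "0 < \<eta>" using \<open>0 < D\<close> \<open>0 < \<gamma>\<close> \<open>0 < r\<close> by (simp add: \<eta>_def)
  from accumulation_point_frequently[OF z half_gt_zero[OF \<open>0 < r\<close>] order_tendstoD(2)[OF small this]]
  obtain k
    where near: "dist (x k) z < r / 2" and tk: "t k * (norm (d k))\<^sup>2 < \<eta>" by blast
  have near': "dist (x k) z < r" using near \<open>0 < r\<close> by simp
  have "obj_grad F i (x k) \<bullet> v \<le> - \<delta>" for i
  proof -
    have "(obj_grad F i (x k) - obj_grad F i z) \<bullet> v
        \<le> norm (obj_grad F i (x k) - obj_grad F i z) * norm v" by (rule norm_cauchy_schwarz)
    also have "\<dots> \<le> \<delta> / norm v * norm v"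
      using r[OF near', of i] by (intro mult_right_mono) (auto simp: \<epsilon>_def)
    finally show ?thesis using \<delta>[of i] \<open>v \<noteq> 0\<close> by (simp add: inner_diff_left)
  qed
  then have D: "D \<le> norm (d k)" by (rule D_le)
  have "t k * D\<^sup>2 \<le> t k * (norm (d k))\<^sup>2"
    using t[of k] D \<open>0 < D\<close> by (intro mult_left_mono power_mono) auto
  also have "\<dots> < D\<^sup>2" using tk by (simp add: \<eta>_def)
  finally have "t k < 1" using \<open>0 < D\<close> by simp
  have "0 < t k / \<gamma>" using t[of k] \<open>0 < \<gamma>\<close> by simp
  from not_armijo_gradient[OF F backtrack[OF \<open>t k < 1\<close>] this] obtain i u where u: "0 < u" "u < t k / \<gamma>"
    and grad: "\<sigma> * (obj_grad F i (x k) \<bullet> d k) < obj_grad F i (x k + u *\<^sub>R d k) \<bullet> d k" .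
  define y where "y = x k + u *\<^sub>R d k"
  have "dist y z < r"
  proof -
    \<comment> \<open>Multiplying by \<open>D \<le> norm (d k)\<close> brings in the small quantity
      \<open>t k * (norm (d k))\<^sup>2\<close>, in place of an upper bound on
      \<open>norm (d k)\<close>.\<close>
    have "u * norm (d k) * D \<le> t k / \<gamma> * norm (d k) * norm (d k)"
      using u D \<open>0 < D\<close> \<open>0 < \<gamma>\<close> t[of k] by (intro mult_mono) auto
    also have "\<dots> < D * r / 2"
      using tk \<open>0 < \<gamma>\<close> by (simp add: \<eta>_def field_simps power2_eq_square)
    finally have "u * norm (d k) < r / 2" using \<open>0 < D\<close> by (simp add: field_simps)
    moreover have "dist y (x k) = u * norm (d k)" using u by (simp add: y_def dist_norm)
    ultimately show ?thesis using near dist_triangle[of y z "x k"] by simp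
  qed
  \<comment> \<open>The factor \<open>1 - \<sigma>\<close> is the gap between the initial slope and
    the \<open>\<sigma>\<close>-fraction of it exceeded at \<open>y\<close>.\<close>
  have "\<kappa> * norm (d k) \<le> (1 - \<sigma>) * (c * (norm (d k))\<^sup>2)"
  proof -
    have "(1 - \<sigma>) * c * (D * norm (d k)) \<le> (1 - \<sigma>) * c * (norm (d k) * norm (d k))"
      using D \<open>\<sigma> < 1\<close> \<open>0 < c\<close> by (intro mult_left_mono mult_right_mono) auto
    then show ?thesis by (simp add: \<kappa>_def power2_eq_square mult.assoc)
  qed
  also have "\<dots> \<le> (1 - \<sigma>) * - (obj_grad F i (x k) \<bullet> d k)"
    using descent[of i k] \<open>\<sigma> < 1\<close> by (intro mult_left_mono) auto
  also have "\<dots> < (obj_grad F i y - obj_grad F i (x k)) \<bullet> d k"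
    using grad by (simp add: y_def inner_diff_left algebra_simps)
  also have "\<dots> \<le> norm (obj_grad F i y - obj_grad F i (x k)) * norm (d k)"
    by (rule norm_cauchy_schwarz)
  finally have "\<kappa> < norm (obj_grad F i y - obj_grad F i (x k))"
    by (rule mult_right_less_imp_less) simp
  also have "\<dots> \<le> norm (obj_grad F i y - obj_grad F i z) + norm (obj_grad F i (x k) - obj_grad F i z)"
    using dist_triangle2[of "obj_grad F i y" "obj_grad F i (x k)" "obj_grad F i z"]
    by (simp add: dist_norm)
  also have "\<dots> < \<kappa>"
    using r[OF near', of i] r[OF \<open>dist y z < r\<close>, of i] by (simp add: \<epsilon>_def)
  finally show False .
qed

theorem theorem5p1:
  fixes F :: "real^'n \<Rightarrow> real^'m"
    and B :: "nat \<Rightarrow> real^'n^'n"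
    and xm1 :: "real^'n"
    and x :: "nat \<Rightarrow> real^'n"
    and \<alpha>min \<alpha>max \<sigma> \<gamma> a b :: real
  assumes "0 < \<alpha>min" and "\<alpha>min \<le> \<alpha>max"
    and "0 < \<sigma>" and "\<sigma> < 1"
    and "0 < \<gamma>" and "\<gamma> < 1"
    and "continuously_differentiable F"
    and "\<And>k. pos_def (B k)"
    and "0 < a" and "0 < b"
    and "\<And>k. loewner_le (a *\<^sub>R mat 1) (B k) \<and> loewner_le (B k) (b *\<^sub>R mat 1)"
    and "\<And>x0. compact (level_set F x0)"
    and "bbdmo_vm_run \<alpha>min \<alpha>max \<sigma> \<gamma> F B xm1 x"
    and "\<And>k. \<not> pareto_critical F (x k)"
  shows "(\<exists>z. accumulation_point x z) \<and>
         (\<forall>z. accumulation_point x z \<longrightarrow> pareto_critical F z)"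
proof -
  have F: "continuously_differentiable F" by fact
  obtain d t where run: "\<And>k. is_arg_min
      (direction_objective F (B k) (bb_alpha \<alpha>min \<alpha>max F B xm1 x k) (x k)) (\<lambda>_. True) (d k)"
    and d: "\<And>k. d k \<noteq> 0" and armijo: "\<And>k. armijo_step \<sigma> \<gamma> F (x k) (d k) (t k)"
    and step: "\<And>k. x (Suc k) = x k + t k *\<^sub>R d k"
    using \<open>bbdmo_vm_run \<alpha>min \<alpha>max \<sigma> \<gamma> F B xm1 x\<close> unfolding bbdmo_vm_run_def by blast
  note t = armijo_step_backtrack[OF armijo \<open>0 < \<gamma>\<close> \<open>\<gamma> < 1\<close>]
  define \<alpha> where "\<alpha> = bb_alpha \<alpha>min \<alpha>max F B xm1 x"
  have \<alpha>: "\<alpha>min \<le> \<alpha> k i" "\<alpha> k i \<le> \<alpha>max" "0 < \<alpha> k i" for k i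
    unfolding \<alpha>_def using \<open>0 < \<alpha>min\<close> \<open>\<alpha>min \<le> \<alpha>max\<close>
    by (simp_all add: bb_alpha_bounds less_le_trans[OF _ bb_alpha_bounds(1)])
  note run = run[folded \<alpha>_def]
  have B: "a * (norm v)\<^sup>2 \<le> (mat_norm (B k) v)\<^sup>2" "(mat_norm (B k) v)\<^sup>2 \<le> b * (norm v)\<^sup>2" for k v
    using assms(11)[of k] \<open>0 < a\<close> loewner_bounds_mat_norm[of a "B k" b v] by auto
  have pos: "0 < mat_norm (B k) (d k)" for k
    using assms(8)[of k] d[of k] by (simp add: mat_norm_def pos_def_def)
  \<comment> \<open>\<open>\<alpha>min\<close> and \<open>a\<close> turn the estimate in the varying
    metric into a Euclidean one whose constant is independent of \<open>k\<close>.\<close>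
  have descent: "obj_grad F i (x k) \<bullet> d k \<le> - (\<alpha>min * a * (norm (d k))\<^sup>2)" for i k
  proof -
    have "obj_grad F i (x k) \<bullet> d k \<le> - (\<alpha> k i * (mat_norm (B k) (d k))\<^sup>2)"
      using minimizer_descent[OF run[of k] pos, of i] \<alpha>(3)[of k i] by (simp add: pos_divide_le_eq mult.commute)
    moreover have "\<alpha>min * (a * (norm (d k))\<^sup>2) \<le> \<alpha> k i * (mat_norm (B k) (d k))\<^sup>2"
      using \<alpha>(1)[of k i] B(1)[of "d k" k] \<open>0 < a\<close> \<alpha>(3)[of k i]
      by (intro mult_mono) auto
    ultimately show ?thesis by (simp add: mult.assoc)
  qed
  have decrease: "\<sigma> * \<alpha>min * a * (t k * (norm (d k))\<^sup>2) \<le> F (x k) $ i - F (x (Suc k)) $ i" for i k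
  proof -
    have "F (x (Suc k)) $ i - F (x k) $ i \<le> t k * \<sigma> * (obj_grad F i (x k) \<bullet> d k)"
      using t(2)[of k] by (simp add: armijo_def step)
    also have "\<dots> \<le> t k * \<sigma> * - (\<alpha>min * a * (norm (d k))\<^sup>2)"
      using t(1)[of k] \<open>0 < \<sigma>\<close> descent by (intro mult_left_mono) auto
    finally show ?thesis by (simp add: algebra_simps)
  qed
  have nonneg: "0 \<le> \<sigma> * \<alpha>min * a * (t k * (norm (d k))\<^sup>2)" for k
    using t(1)[of k] \<open>0 < \<sigma>\<close> \<open>0 < \<alpha>min\<close> \<open>0 < a\<close> by simp
  have level: "x k \<in> level_set F (x 0)" for k
  proof -
    have "F (x k) $ i \<le> F (x 0) $ i" for i
    proof (induction k)
      case (Suc k)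
      with decrease[of k i] nonneg[of k] show ?case by linarith
    qed simp
    then show ?thesis by (simp add: level_set_def)
  qed
  have compact: "compact (level_set F (x 0))" by fact
  have small: "(\<lambda>k. t k * (norm (d k))\<^sup>2) \<longlonglongrightarrow> 0"
  proof -
    \<comment> \<open>Any one component will do, and the index type is nonempty; its minimum on the
      compact level set is the lower bound for its values.\<close>
    fix i :: 'm
    have "continuous_on UNIV (\<lambda>y. F y $ i)"
      using has_derivative_obj_grad[OF F]
      by (intro continuous_at_imp_continuous_on) (blast intro: has_derivative_continuous)
    then have "continuous_on (level_set F (x 0)) (\<lambda>y. F y $ i)"
      by (rule continuous_on_subset) simp
    from continuous_attains_inf[OF compact _ this] level obtain y
      where y: "\<And>k. F y $ i \<le> F (x k) $ i" by blast
    have "(\<lambda>k. \<sigma> * \<alpha>min * a * (t k * (norm (d k))\<^sup>2)) \<longlonglongrightarrow> 0"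
      by (rule bounded_descent_tendsto_0[where f = "\<lambda>k. F (x k) $ i", OF nonneg decrease y])
    from tendsto_mult_left[OF this, of "inverse (\<sigma> * \<alpha>min * a)"] show ?thesis
      using \<open>0 < \<sigma>\<close> \<open>0 < \<alpha>min\<close> \<open>0 < a\<close> by (simp add: field_simps)
  qed
  have ex: "\<exists>z. accumulation_point x z"
    using compact level unfolding compact_def accumulation_point_def by blast
  have lower: "\<exists>D>0. \<forall>k. (\<forall>i. obj_grad F i (x k) \<bullet> v \<le> - \<delta>) \<longrightarrow> D \<le> norm (d k)"
    if "0 < \<delta>" for v \<delta>
  \<comment> \<open>For \<open>v = 0\<close> the premise contradicts \<open>0 < \<delta>\<close>, so
    the witness \<open>1\<close> is arbitrary.\<close>
  proof (cases "v = 0")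
    case False
    then have "0 < \<delta> / (\<alpha>max * b * norm v)"
      using that \<open>0 < \<alpha>min\<close> \<open>\<alpha>min \<le> \<alpha>max\<close> \<open>0 < b\<close> by simp
    moreover have "\<delta> / (\<alpha>max * b * norm v) \<le> norm (d k)"
      if "\<forall>i. obj_grad F i (x k) \<bullet> v \<le> - \<delta>" for k
      by (rule minimizer_norm_lower_bound[OF run pos B(2) \<open>0 < b\<close> \<alpha>(3) \<alpha>(2) _ \<open>0 < \<delta>\<close>])
        (simp add: that)
    ultimately show ?thesis by blast
  qed (use that in \<open>auto intro: exI[of _ 1]\<close>)
  have "0 < \<alpha>min * a" using \<open>0 < \<alpha>min\<close> \<open>0 < a\<close> by simp
  from accumulation_point_pareto_critical[OF F \<open>\<sigma> < 1\<close> \<open>0 < \<gamma>\<close> this t(1,3) descent lower small]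
  have "\<forall>z. accumulation_point x z \<longrightarrow> pareto_critical F z" by blast
  with ex show ?thesis ..
qed

end
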